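(* For $f\in C_{\varphi(T)}$, assume that $\theta_1,\theta_2\colon V^{\vee}\xrightarrow{\sim}V$ are isomorphisms and $\kappa_1,\kappa_2\colon V\to V^{\vee}$ are linear maps satisfying $f=\theta_1\circ\kappa_1=\theta_2\circ\kappa_2$, ${}^t\theta_1=\theta_1$, ${}^t\theta_2=\theta_2$, ${}^t\kappa_1=\kappa_1$ and ${}^t\kappa_2=\kappa_2$. Then there exists $\overline{P(T)}\in(\mathbb C[T]/(\varphi(T)))^{\times}$ satisfying $\theta_2=\theta_1\circ P({}^tf)$ and $\kappa_2=(P({}^tf))^{-1}\circ\kappa_1$.
   Context: $V$ is a vector space over $\mathbb C$ of dimension $r$, $\varphi(T)\in\mathbb C[T]$ is a monic polynomial of degree $r$, and $C_{\varphi(T)}$ is the set of linear maps $f\colon V\to V$ whose minimal polynomial is $\varphi(T)$. $V^\vee$ is the dual space, ${}^tf\colon V^\vee\to V^\vee$ is the dual of $f$, and for $\theta\colon V^\vee\to V$, $\kappa\colon V\to V^\vee$ the maps ${}^t\theta\colon V^\vee\to V$, ${}^t\kappa\colon V\to V^\vee$ are the duals, using $(V^\vee)^\vee=V$. *)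

theory Defs
  imports "HOL-Algebra.Algebraic_Closure_Type"
begin

subsection \<open>Complex vector spaces\<close>

class complex_vector = ab_group_add +
  fixes scaleC :: "complex \<Rightarrow> 'a \<Rightarrow> 'a"
  assumes scaleC_add_right: "scaleC a (x + y) = scaleC a x + scaleC a y"
    and scaleC_add_left: "scaleC (a + b) x = scaleC a x + scaleC b x"
    and scaleC_scaleC: "scaleC a (scaleC b x) = scaleC (a * b) x"
    and scaleC_one: "scaleC 1 x = x"

global_interpretation complex_vector: vector_space
  "scaleC :: complex \<Rightarrow> 'a \<Rightarrow> 'a :: complex_vector"
  by unfold_locales
    (rule scaleC_add_right scaleC_add_left scaleC_scaleC scaleC_one)+

instantiation complex :: complex_vector
begin
definition scaleC_complex :: "complex \<Rightarrow> complex \<Rightarrow> complex" where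
  "scaleC_complex = (*)"
instance
  by standard (simp_all add: scaleC_complex_def algebra_simps)
end

lemma scaleC_complex: "scaleC a b = a * b" for a b :: complex
  by (simp add: scaleC_complex_def)

abbreviation clinear :: "('a :: complex_vector \<Rightarrow> 'b :: complex_vector) \<Rightarrow> bool" where
  "clinear \<equiv> Vector_Spaces.linear scaleC scaleC"

lemma clinear_iff:
  "clinear f \<longleftrightarrow> (\<forall>x y. f (x + y) = f x + f y) \<and> (\<forall>c x. f (scaleC c x) = scaleC c (f x))"
  unfolding Vector_Spaces.linear_def module_hom_def module_hom_axioms_def
  by (simp add: complex_vector.module_axioms complex_vector.vector_space_axioms)

subsection \<open>Dual spaces\<close>

typedef (overloaded) 'a dual_space = "{\<phi> :: 'a :: complex_vector \<Rightarrow> complex. clinear \<phi>}"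
  morphisms dual_apply Abs_dual
  by (rule exI[of _ "\<lambda>_. 0"]) (simp add: clinear_iff scaleC_complex)

setup_lifting type_definition_dual_space

instantiation dual_space :: (complex_vector) complex_vector
begin
lift_definition zero_dual_space :: "'a dual_space" is "\<lambda>_. 0"
  by (simp add: clinear_iff scaleC_complex)
lift_definition plus_dual_space :: "'a dual_space \<Rightarrow> 'a dual_space \<Rightarrow> 'a dual_space"
  is "\<lambda>\<phi> \<psi> v. \<phi> v + \<psi> v"
  by (simp add: clinear_iff scaleC_complex algebra_simps)
lift_definition minus_dual_space :: "'a dual_space \<Rightarrow> 'a dual_space \<Rightarrow> 'a dual_space"
  is "\<lambda>\<phi> \<psi> v. \<phi> v - \<psi> v"
  by (simp add: clinear_iff scaleC_complex algebra_simps)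
lift_definition uminus_dual_space :: "'a dual_space \<Rightarrow> 'a dual_space"
  is "\<lambda>\<phi> v. - \<phi> v"
  by (simp add: clinear_iff scaleC_complex)
lift_definition scaleC_dual_space :: "complex \<Rightarrow> 'a dual_space \<Rightarrow> 'a dual_space"
  is "\<lambda>c \<phi> v. c * \<phi> v"
  by (simp add: clinear_iff scaleC_complex algebra_simps)
instance
  by standard (transfer, simp add: fun_eq_iff algebra_simps)+
end

text \<open>\<open>Abs_dual\<close> is meaningful here only when \<open>g\<close> is linear.\<close>

definition dual_map ::
  "('a :: complex_vector \<Rightarrow> 'b :: complex_vector) \<Rightarrow> 'b dual_space \<Rightarrow> 'a dual_space" where
  "dual_map g \<phi> = Abs_dual (\<lambda>v. dual_apply \<phi> (g v))"

text \<open>The canonical map to the bidual, which identifies the two spaces in finite dimension.\<close>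

definition bidual :: "'a :: complex_vector \<Rightarrow> 'a dual_space dual_space" where
  "bidual v = Abs_dual (\<lambda>\<phi>. dual_apply \<phi> v)"

definition dual_map_from_dual ::
  "('a :: complex_vector dual_space \<Rightarrow> 'a) \<Rightarrow> 'a dual_space \<Rightarrow> 'a" where
  "dual_map_from_dual \<theta> = inv_into UNIV bidual \<circ> dual_map \<theta>"

definition dual_map_to_dual ::
  "('a :: complex_vector \<Rightarrow> 'a dual_space) \<Rightarrow> 'a \<Rightarrow> 'a dual_space" where
  "dual_map_to_dual \<kappa> = dual_map \<kappa> \<circ> bidual"

lemma dual_apply_clinear: "clinear (dual_apply \<phi>)"
  using dual_apply by auto

lemma dual_apply_dual_map: "clinear g \<Longrightarrow> dual_apply (dual_map g \<phi>) v = dual_apply \<phi> (g v)"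
  using dual_apply_clinear[of \<phi>] unfolding dual_map_def
  by (subst Abs_dual_inverse) (auto simp: clinear_iff)

lemma dual_apply_bidual: "dual_apply (bidual v) \<phi> = dual_apply \<phi> v"
  unfolding bidual_def
  by (subst Abs_dual_inverse)
    (auto simp: clinear_iff plus_dual_space.rep_eq scaleC_dual_space.rep_eq scaleC_complex)

lemma bij_bidual:
  assumes "finite_dimensional_vector_space
      (scaleC :: complex \<Rightarrow> 'a \<Rightarrow> 'a :: complex_vector) B"
  shows "bij (bidual :: 'a \<Rightarrow> 'a dual_space dual_space)"
proof -
  interpret finite_dimensional_vector_space "scaleC :: complex \<Rightarrow> 'a \<Rightarrow> 'a" B
    by fact
  define e where "e b = Abs_dual (\<lambda>v. complex_vector.representation B v b)" for b
  have e: "dual_apply (e b) v = complex_vector.representation B v b" for b v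
    unfolding e_def
    by (subst Abs_dual_inverse)
      (auto simp: clinear_iff scaleC_complex span_Basis independent_Basis
        complex_vector.representation_add complex_vector.representation_scale)
  have rep: "(\<Sum>b\<in>B. scaleC (dual_apply (e b) v) b) = v" for v
    using complex_vector.sum_representation_eq[of B v B] by (simp add: e finite_Basis span_Basis independent_Basis)
  have sum_apply: "dual_apply \<phi> (\<Sum>b\<in>B. scaleC (c b) b) = (\<Sum>b\<in>B. c b * dual_apply \<phi> b)"
    for \<phi> :: "'a dual_space" and c
  proof -
    interpret l: Vector_Spaces.linear "scaleC :: complex \<Rightarrow> 'a \<Rightarrow> 'a" scaleC "dual_apply \<phi>"
      by (rule dual_apply_clinear)
    show ?thesis by (simp add: l.sum l.scale scaleC_complex)
  qed
  have apply_sum: "dual_apply \<Phi> (\<Sum>b\<in>B. scaleC (c b) (e b)) = (\<Sum>b\<in>B. c b * dual_apply \<Phi> (e b))"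
    for \<Phi> :: "'a dual_space dual_space" and c
  proof -
    interpret l: Vector_Spaces.linear "scaleC :: complex \<Rightarrow> 'a dual_space \<Rightarrow> _" scaleC "dual_apply \<Phi>"
      by (rule dual_apply_clinear)
    show ?thesis by (simp add: l.sum l.scale scaleC_complex)
  qed
  have dual_sum: "dual_apply (\<Sum>b\<in>B. scaleC (c b) (e b)) v = (\<Sum>b\<in>B. c b * dual_apply (e b) v)"
    for c v
    using apply_sum[of "bidual v" c] by (simp add: dual_apply_bidual)
  have exp: "\<phi> = (\<Sum>b\<in>B. scaleC (dual_apply \<phi> b) (e b))" for \<phi>
  proof (rule dual_apply_inject[THEN iffD1], rule ext)
    fix v
    show "dual_apply \<phi> v = dual_apply (\<Sum>b\<in>B. scaleC (dual_apply \<phi> b) (e b)) v"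
      using sum_apply[of \<phi> "\<lambda>b. dual_apply (e b) v"] by (simp add: rep dual_sum mult.commute)
  qed
  show ?thesis
  proof (rule bijI)
    show "inj (bidual :: 'a \<Rightarrow> _)"
      by (rule injI) (metis (no_types, lifting) dual_apply_bidual rep sum.cong)
    show "surj (bidual :: 'a \<Rightarrow> _)"
    proof (rule surjI)
      fix \<Phi> :: "'a dual_space dual_space"
      show "bidual (\<Sum>b\<in>B. scaleC (dual_apply \<Phi> (e b)) b) = \<Phi>"
      proof (rule dual_apply_inject[THEN iffD1], rule ext)
        fix \<phi> :: "'a dual_space"
        have "dual_apply \<Phi> \<phi> = dual_apply \<Phi> (\<Sum>b\<in>B. scaleC (dual_apply \<phi> b) (e b))"
          using exp[of \<phi>] by simp
        also have "\<dots> = dual_apply (bidual (\<Sum>b\<in>B. scaleC (dual_apply \<Phi> (e b)) b)) \<phi>"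
          by (simp add: apply_sum dual_apply_bidual sum_apply mult.commute)
        finally show "dual_apply (bidual (\<Sum>b\<in>B. scaleC (dual_apply \<Phi> (e b)) b)) \<phi> = dual_apply \<Phi> \<phi>" ..
      qed
    qed
  qed
qed

subsection \<open>Polynomials of endomorphisms\<close>

definition poly_endo :: "complex poly \<Rightarrow> ('a :: complex_vector \<Rightarrow> 'a) \<Rightarrow> 'a \<Rightarrow> 'a" where
  "poly_endo p f v = (\<Sum>i\<le>Polynomial.degree p. scaleC (Polynomial.coeff p i) ((f ^^ i) v))"

definition is_minimal_poly :: "complex poly \<Rightarrow> ('a :: complex_vector \<Rightarrow> 'a) \<Rightarrow> bool" where
  "is_minimal_poly p f \<longleftrightarrow> Polynomial.lead_coeff p = 1 \<and> poly_endo p f = (\<lambda>_. 0) \<and>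
     (\<forall>q. q \<noteq> 0 \<longrightarrow> poly_endo q f = (\<lambda>_. 0) \<longrightarrow> Polynomial.degree p \<le> Polynomial.degree q)"

definition endos_with_minimal_poly :: "complex poly \<Rightarrow> ('a :: complex_vector \<Rightarrow> 'a) set" where
  "endos_with_minimal_poly p = {f. clinear f \<and> is_minimal_poly p f}"

subsection \<open>The quotient of the polynomial ring by a principal ideal\<close>

definition poly_quot :: "complex poly \<Rightarrow> complex poly set ring" where
  "poly_quot p = ring_of_type_algebra Quot (PIdl\<^bsub>ring_of_type_algebra\<^esub> p)"

end

theory Submission
  imports Defs
begin

text \<open>
  The automorphism \<open>g = \<theta>2 \<circ> \<theta>1\<^sup>-\<^sup>1\<close> of \<open>V\<close> commutes with \<open>f\<close>, because symmetry of the maps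
  gives \<open>f \<circ> \<theta>i = \<theta>i \<circ> \<^sup>tf\<close> for both \<open>i\<close>. As the minimal polynomial of \<open>f\<close> has degree \<open>dim V\<close>,
  there is a cyclic vector, and hence everything commuting with \<open>f\<close> is a polynomial in \<open>f\<close>.
  So \<open>g = P(f)\<close> and \<open>g\<^sup>-\<^sup>1 = Q(f)\<close>, whence \<open>PQ \<equiv> 1\<close> modulo \<open>\<phi>\<close> and
  \<open>\<theta>2 = P(f) \<circ> \<theta>1 = \<theta>1 \<circ> P(\<^sup>tf)\<close>.
\<close>

subsection \<open>Polynomials of endomorphisms\<close>

lemma clinear_add: "clinear f \<Longrightarrow> f (x + y) = f x + f y"
  and clinear_scale: "clinear f \<Longrightarrow> f (scaleC c x) = scaleC c (f x)"
  by (simp_all add: clinear_iff)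

lemma clinear_zero: "clinear f \<Longrightarrow> f 0 = 0"
  using clinear_add[of f 0 0] by simp

lemma clinear_sum: "clinear f \<Longrightarrow> f (\<Sum>i\<in>A. g i) = (\<Sum>i\<in>A. f (g i))"
  by (induction A rule: infinite_finite_induct) (simp_all add: clinear_add clinear_zero)

lemma clinear_compose: "clinear f \<Longrightarrow> clinear g \<Longrightarrow> clinear (\<lambda>x. f (g x))"
  by (simp add: clinear_iff)

text \<open>Coefficients beyond the degree vanish. A freely chosen bound lets polynomials of
  different degrees share one range of summation.\<close>

lemma poly_endo_altdef:
  assumes "Polynomial.degree p \<le> n"
  shows "poly_endo p f v = (\<Sum>i\<le>n. scaleC (Polynomial.coeff p i) ((f ^^ i) v))"
  unfolding poly_endo_def using assms
  by (intro sum.mono_neutral_left) (auto simp: Polynomial.coeff_eq_0)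

lemma poly_endo_0 [simp]: "poly_endo 0 f v = 0"
  by (simp add: poly_endo_def)

text \<open>Horner's rule, the inductive step for linearity, intertwining and multiplicativity
  below.\<close>

lemma poly_endo_pCons:
  assumes "clinear f"
  shows "poly_endo (pCons a p) f v = scaleC a v + f (poly_endo p f v)"
proof -
  have "poly_endo (pCons a p) f v =
      (\<Sum>i\<le>Suc (Polynomial.degree p). scaleC (Polynomial.coeff (pCons a p) i) ((f ^^ i) v))"
    by (rule poly_endo_altdef) (rule degree_pCons_le)
  also have "\<dots> = scaleC a v +
      (\<Sum>i\<le>Polynomial.degree p. scaleC (Polynomial.coeff p i) (f ((f ^^ i) v)))"
    by (subst sum.atMost_Suc_shift) simp
  also have "(\<Sum>i\<le>Polynomial.degree p. scaleC (Polynomial.coeff p i) (f ((f ^^ i) v))) =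
      f (poly_endo p f v)"
    by (simp add: poly_endo_def clinear_sum[OF assms] clinear_scale[OF assms])
  finally show ?thesis .
qed

lemma poly_endo_add: "poly_endo (p + q) f v = poly_endo p f v + poly_endo q f v"
proof -
  let ?n = "max (Polynomial.degree p) (Polynomial.degree q)"
  have "Polynomial.degree (p + q) \<le> ?n"
    by (rule Polynomial.degree_add_le) simp_all
  then show ?thesis
    by (simp add: poly_endo_altdef[of _ ?n] scaleC_add_left sum.distrib)
qed

lemma poly_endo_smult: "poly_endo (Polynomial.smult c p) f v = scaleC c (poly_endo p f v)"
  by (simp add: poly_endo_altdef[of _ "Polynomial.degree p"] complex_vector.scale_sum_right)

lemma poly_endo_1 [simp]: "poly_endo 1 f v = v"
  by (simp add: poly_endo_def scaleC_one)

lemma clinear_poly_endo: "clinear f \<Longrightarrow> clinear (poly_endo p f)"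
  by (induction p)
    (auto simp: clinear_iff poly_endo_pCons scaleC_add_right scaleC_scaleC algebra_simps)

text \<open>Used with \<open>h\<close> an endomorphism commuting with \<open>f\<close>, and with
  \<open>h = \<theta>1\<close> to pass from the dual of \<open>f\<close> to
  \<open>f\<close>.\<close>

lemma poly_endo_intertwine:
  assumes "clinear f" "clinear g" "clinear h" and "\<And>x. h (f x) = g (h x)"
  shows "h (poly_endo p f x) = poly_endo p g (h x)"
  by (induction p)
    (simp_all add: assms poly_endo_pCons clinear_zero clinear_add clinear_scale)

lemma poly_endo_mult:
  assumes "clinear f"
  shows "poly_endo (p * q) f v = poly_endo p f (poly_endo q f v)"
  by (induction p)
    (simp_all add: poly_endo_pCons[OF assms] mult_pCons_left poly_endo_add poly_endo_smult
      complex_vector.scale_zero_left)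

text \<open>Translates linear combinations of the iterates of a vector into polynomials in
  \<open>f\<close>.\<close>

lemma poly_endo_sum_monom:
  "poly_endo (\<Sum>i\<in>A. Polynomial.monom (c i) i) f v = (\<Sum>i\<in>A. scaleC (c i) ((f ^^ i) v))"
proof (induction A rule: infinite_finite_induct)
  case (insert i A)
  have "poly_endo (Polynomial.monom (c i) i) f v =
      (\<Sum>j\<le>i. scaleC (Polynomial.coeff (Polynomial.monom (c i) i) j) ((f ^^ j) v))"
    by (rule poly_endo_altdef) (rule degree_monom_le)
  also have "\<dots> = (\<Sum>j\<le>i. if j = i then scaleC (c i) ((f ^^ i) v) else 0)"
    by (rule sum.cong) auto
  finally have "poly_endo (Polynomial.monom (c i) i) f v = scaleC (c i) ((f ^^ i) v)"
    by simp
  with insert show ?case by (simp add: poly_endo_add)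
qed simp_all

subsection \<open>Cyclic vectors\<close>

text \<open>The kernels are proper subspaces, and over an infinite field finitely many of these
  cannot cover the space.\<close>

lemma ex_common_nonzero:
  fixes h :: "'i \<Rightarrow> 'a :: complex_vector \<Rightarrow> 'b :: complex_vector"
  assumes "finite S" and "\<And>i. i \<in> S \<Longrightarrow> clinear (h i)" and "\<And>i. i \<in> S \<Longrightarrow> \<exists>v. h i v \<noteq> 0"
  shows "\<exists>v. \<forall>i\<in>S. h i v \<noteq> 0"
  using assms
proof (induction S rule: finite_induct)
  case (insert i S)
  obtain v where v: "\<forall>j\<in>S. h j v \<noteq> 0" using insert by auto
  obtain u where u: "h i u \<noteq> 0" using insert.prems by auto
  \<comment> \<open>On the line \<open>u + c v\<close> each map vanishes for at most one value of \<open>c\<close>.\<close>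
  define bad where "bad j = {c. h j (u + scaleC c v) = 0}" for j
  have "finite (bad j)" if j: "j \<in> insert i S" for j
  proof (cases "bad j = {}")
    case False
    then obtain c where c: "h j (u + scaleC c v) = 0" by (auto simp: bad_def)
    have lin: "clinear (h j)" using insert.prems(1) j .
    note hj = clinear_add[OF lin] clinear_scale[OF lin]
    \<comment> \<open>Otherwise \<open>h j\<close> is constant on the line, with value
      \<open>h j u = 0\<close>. The choice of \<open>v\<close> excludes this for \<open>j\<close> in
      \<open>S\<close>, the choice of \<open>u\<close> for \<open>j = i\<close>.\<close>
    have "h j v \<noteq> 0"
    proof
      assume "h j v = 0"
      then have "h j u = 0" using c by (simp add: hj complex_vector.scale_zero_right)
      moreover have "j = i" using \<open>h j v = 0\<close> j v by blast
      ultimately show False using u by simp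
    qed
    moreover have "scaleC d (h j v) = scaleC c (h j v)" if "d \<in> bad j" for d
    proof -
      have "h j u + scaleC d (h j v) = h j u + scaleC c (h j v)"
        using that c by (simp add: bad_def hj)
      then show ?thesis by (rule add_left_imp_eq)
    qed
    ultimately have "bad j \<subseteq> {c}"
      using complex_vector.scale_right_imp_eq by blast
    then show ?thesis by (rule finite_subset) simp
  qed simp
  then have "finite (\<Union>j\<in>insert i S. bad j)"
    using insert.hyps by auto
  then obtain c where "c \<notin> (\<Union>j\<in>insert i S. bad j)"
    using ex_new_if_finite[OF infinite_UNIV_char_0] by metis
  then show ?case by (auto simp: bad_def)
qed simp

text \<open>The remainder of \<open>q\<close> modulo \<phi> also kills the whole space and has
  smaller degree, so minimality makes it zero.\<close>

lemma minimal_poly_dvd: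
  assumes "clinear f" and min: "is_minimal_poly \<phi> f" and q: "\<And>v. poly_endo q f v = 0"
  shows "\<phi> dvd q"
proof (rule ccontr)
  assume "\<not> \<phi> dvd q"
  then have nz: "q mod \<phi> \<noteq> 0" by (simp add: dvd_eq_mod_eq_0)
  have "\<phi> \<noteq> 0" using min by (auto simp: is_minimal_poly_def)
  then have less: "Polynomial.degree (q mod \<phi>) < Polynomial.degree \<phi>"
    using nz by (rule degree_mod_less')
  have "poly_endo (q mod \<phi>) f v = 0" for v
  proof -
    have "poly_endo (q div \<phi> * \<phi> + q mod \<phi>) f v = 0" using q by simp
    moreover have "poly_endo (q div \<phi> * \<phi>) f v = 0"
      using min clinear_zero[OF clinear_poly_endo[OF assms(1)]]
      by (simp add: poly_endo_mult[OF assms(1)] is_minimal_poly_def)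
    ultimately show ?thesis by (simp only: poly_endo_add) simp
  qed
  then have "poly_endo (q mod \<phi>) f = (\<lambda>_. 0)" by (rule ext)
  then have "Polynomial.degree \<phi> \<le> Polynomial.degree (q mod \<phi>)"
    using min nz unfolding is_minimal_poly_def by blast
  then show False using less by simp
qed

text \<open>
  Choose \<open>v\<close> outside the kernel of \<open>(\<phi>/(T - a))(f)\<close> for every root \<open>a\<close> of \<open>\<phi>\<close>. The
  annihilator \<open>m\<close> of \<open>v\<close> divides \<open>\<phi>\<close>, and a root \<open>a\<close> of \<open>\<phi>/m\<close> would make \<open>m\<close> divide
  \<open>\<phi>/(T - a)\<close>, which does not kill \<open>v\<close>.
\<close>

lemma ex_cyclic_vector:
  assumes lin: "clinear f" and min: "is_minimal_poly \<phi> f"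
  obtains v where
    "\<And>q. poly_endo q f v = 0 \<Longrightarrow> Polynomial.degree q < Polynomial.degree \<phi> \<Longrightarrow> q = 0"
proof -
  have phi0: "\<phi> \<noteq> 0" and phi_f: "poly_endo \<phi> f v = 0" for v
    using min by (auto simp: is_minimal_poly_def)
  define S where "S = {a. poly \<phi> a = 0}"
  define \<psi> where "\<psi> a = \<phi> div [:- a, 1:]" for a
  have \<psi>: "\<phi> = [:- a, 1:] * \<psi> a" if "a \<in> S" for a
    using that dvd_mult_div_cancel[of "[:- a, 1:]" \<phi>]
    unfolding S_def \<psi>_def by (simp only: poly_eq_0_iff_dvd mem_Collect_eq)
  \<comment> \<open>\<open>\<psi> a\<close> is nonzero of degree one less than \<phi>, so it cannot
    kill the whole space.\<close>
  have "\<exists>v. poly_endo (\<psi> a) f v \<noteq> 0" if "a \<in> S" for a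
  proof (rule ccontr)
    assume "\<not> ?thesis"
    moreover have "\<psi> a \<noteq> 0" using \<psi>[OF that] phi0 by auto
    ultimately have "Polynomial.degree \<phi> \<le> Polynomial.degree (\<psi> a)"
      using min by (auto simp: is_minimal_poly_def)
    moreover have "Polynomial.degree \<phi> = Suc (Polynomial.degree (\<psi> a))"
      using \<open>\<psi> a \<noteq> 0\<close> by (subst \<psi>[OF that], subst degree_mult_eq) auto
    ultimately show False by simp
  qed
  moreover have "finite S" unfolding S_def by (rule poly_roots_finite[OF phi0])
  ultimately obtain v where v: "\<And>a. a \<in> S \<Longrightarrow> poly_endo (\<psi> a) f v \<noteq> 0"
    using ex_common_nonzero[of S "\<lambda>a. poly_endo (\<psi> a) f"] clinear_poly_endo[OF lin] by blast
  \<comment> \<open>\<phi> itself is a nonzero polynomial killing \<open>v\<close>, so the minimum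
    is attained.\<close>
  define m where "m = (ARG_MIN Polynomial.degree m. m \<noteq> 0 \<and> poly_endo m f v = 0)"
  have m: "m \<noteq> 0" "poly_endo m f v = 0"
    using arg_min_natI[of "\<lambda>m. m \<noteq> 0 \<and> poly_endo m f v = 0" \<phi> Polynomial.degree] phi0 phi_f
    by (simp_all add: m_def)
  have m_le: "Polynomial.degree m \<le> Polynomial.degree q" if "q \<noteq> 0" "poly_endo q f v = 0" for q
    unfolding m_def using that by (intro arg_min_nat_le) simp
  \<comment> \<open>Division with remainder again, now for annihilation of the single vector
    \<open>v\<close>.\<close>
  have "m dvd \<phi>"
  proof (rule ccontr)
    assume "\<not> m dvd \<phi>"
    then have nz: "\<phi> mod m \<noteq> 0" by (simp add: dvd_eq_mod_eq_0)
    have "poly_endo (\<phi> div m * m + \<phi> mod m) f v = 0" using phi_f by simp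
    moreover have "poly_endo (\<phi> div m * m) f v = 0"
      using m clinear_zero[OF clinear_poly_endo[OF lin]] by (simp add: poly_endo_mult[OF lin])
    ultimately have "poly_endo (\<phi> mod m) f v = 0" by (simp only: poly_endo_add) simp
    then show False using m_le[OF nz] degree_mod_less'[OF m(1) nz] by simp
  qed
  then obtain k where k: "\<phi> = k * m" by (metis dvd_def mult.commute)
  have "Polynomial.degree k = 0"
  proof (rule ccontr)
    assume "Polynomial.degree k \<noteq> 0"
    then obtain a where a: "poly k a = 0"
      using fundamental_theorem_of_algebra[of k] by (auto simp: constant_degree)
    then obtain l where l: "k = [:- a, 1:] * l" by (auto simp: poly_eq_0_iff_dvd)
    have "a \<in> S" using a by (simp add: S_def k)
    have "[:- a, 1:] * \<psi> a = [:- a, 1:] * (l * m)"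
      using \<psi>[OF \<open>a \<in> S\<close>] by (simp only: k l mult.assoc)
    then have "\<psi> a = l * m" by (subst (asm) mult_cancel_left) simp
    then have "poly_endo (\<psi> a) f v = 0"
      using m clinear_zero[OF clinear_poly_endo[OF lin]] by (simp add: poly_endo_mult[OF lin])
    then show False using v \<open>a \<in> S\<close> by blast
  qed
  moreover have "k \<noteq> 0" using phi0 k by auto
  ultimately have "Polynomial.degree m = Polynomial.degree \<phi>"
    using m k by (simp add: degree_mult_eq)
  then show thesis using m_le by (intro that[of v]) (force simp: not_le[symmetric])
qed

text \<open>A linear relation among the first \<open>dim V\<close> iterates of \<open>v\<close> is a
  polynomial of degree below \<open>dim V\<close> killing \<open>v\<close>. So these iterates are
  independent, and by their number they span.\<close>

lemma cyclic_vector_generates: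
  fixes f :: "'v :: complex_vector \<Rightarrow> 'v"
  assumes "finite_dimensional_vector_space (scaleC :: complex \<Rightarrow> 'v \<Rightarrow> 'v) B"
    and v: "\<And>q. poly_endo q f v = 0 \<Longrightarrow>
      Polynomial.degree q < vector_space.dim (scaleC :: complex \<Rightarrow> 'v \<Rightarrow> 'v) UNIV \<Longrightarrow> q = 0"
  obtains p where "w = poly_endo p f v"
proof -
  interpret finite_dimensional_vector_space "scaleC :: complex \<Rightarrow> 'v \<Rightarrow> 'v" B by fact
  let ?d = "complex_vector.dim (UNIV :: 'v set)"
  have small: "c i = 0" if "(\<Sum>i<?d. scaleC (c i) ((f ^^ i) v)) = 0" and "i < ?d" for c i
  proof -
    let ?q = "\<Sum>i<?d. Polynomial.monom (c i) i"
    \<comment> \<open>As \<open>i < ?d\<close>, the dimension is positive, so this bound is strictly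
      below \<open>?d\<close>.\<close>
    have "Polynomial.degree ?q \<le> ?d - 1"
      by (rule Polynomial.degree_sum_le) (auto intro: order.trans[OF degree_monom_le])
    then have "?q = 0"
      using that by (intro v) (simp_all add: poly_endo_sum_monom)
    then have "Polynomial.coeff ?q i = 0" by simp
    then show ?thesis using \<open>i < ?d\<close> by (simp add: Polynomial.coeff_sum)
  qed
  let ?g = "\<lambda>i. (f ^^ i) v"
  \<comment> \<open>Independence concerns the set of iterates, so they must be distinct. Two equal
    ones would give a relation with coefficients 1 and -1.\<close>
  have inj: "inj_on ?g {..<?d}"
  proof (rule inj_onI, rule ccontr)
    fix i j assume ij: "i \<in> {..<?d}" "j \<in> {..<?d}" "?g i = ?g j" "i \<noteq> j"
    have "(\<Sum>k<?d. scaleC ((if k = i then 1 else 0) - (if k = j then 1 else 0)) (?g k)) =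
        (\<Sum>k<?d. if k = i then ?g k else 0) - (\<Sum>k<?d. if k = j then ?g k else 0)"
      unfolding sum_subtractf[symmetric]
      by (rule sum.cong) (auto simp: scaleC_one complex_vector.scale_left_diff_distrib)
    also have "\<dots> = 0" using ij by simp
    finally show False using small[of "\<lambda>k. (if k = i then 1 else 0) - (if k = j then 1 else 0)" i] ij
      by simp
  qed
  have "complex_vector.independent (?g ` {..<?d})"
  proof (rule complex_vector.independent_if_scalars_zero)
    fix u x assume "(\<Sum>x\<in>?g ` {..<?d}. scaleC (u x) x) = 0" "x \<in> ?g ` {..<?d}"
    then show "u x = 0" using small[of "\<lambda>i. u (?g i)"]
      unfolding sum.reindex[OF inj] by auto
  qed simp
  then have "UNIV \<subseteq> complex_vector.span (?g ` {..<?d})"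
    by (intro card_ge_dim_independent) (simp_all only: card_image[OF inj] card_lessThan order.refl subset_UNIV not_False_eq_True)
  then have "w \<in> complex_vector.span (?g ` {..<?d})" by auto
  then obtain u where "w = (\<Sum>x\<in>?g ` {..<?d}. scaleC (u x) x)"
    by (auto simp: complex_vector.span_finite)
  also have "\<dots> = poly_endo (\<Sum>i<?d. Polynomial.monom (u (?g i)) i) f v"
    unfolding sum.reindex[OF inj] by (simp add: poly_endo_sum_monom)
  finally show thesis by (rule that)
qed

text \<open>A map commuting with \<open>f\<close> is determined by its value at a cyclic vector
  \<open>v\<close>: if \<open>g v = P(f) v\<close> and \<open>w = R(f) v\<close>, then
  \<open>g w = R(f) P(f) v = P(f) w\<close>.\<close>

lemma commuting_is_poly_endo:
  fixes f :: "'v :: complex_vector \<Rightarrow> 'v"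
  assumes fin: "finite_dimensional_vector_space (scaleC :: complex \<Rightarrow> 'v \<Rightarrow> 'v) B"
    and lin: "clinear f" and min: "is_minimal_poly \<phi> f"
    and deg: "Polynomial.degree \<phi> = vector_space.dim (scaleC :: complex \<Rightarrow> 'v \<Rightarrow> 'v) UNIV"
    and g: "clinear g" and comm: "\<And>x. g (f x) = f (g x)"
  obtains P where "g = poly_endo P f"
proof -
  obtain v where v: "\<And>q. poly_endo q f v = 0 \<Longrightarrow> Polynomial.degree q < Polynomial.degree \<phi> \<Longrightarrow> q = 0"
    by (rule ex_cyclic_vector[OF lin min]) blast
  note generates = cyclic_vector_generates[OF fin v[unfolded deg]]
  obtain P where P: "g v = poly_endo P f v" by (rule generates)
  have "g w = poly_endo P f w" for w
  proof -
    obtain R where R: "w = poly_endo R f v" by (rule generates)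
    have "g w = poly_endo R f (g v)"
      unfolding R by (rule poly_endo_intertwine[OF lin lin g comm])
    also have "\<dots> = poly_endo P f w"
      by (simp add: P R poly_endo_mult[OF lin, symmetric] mult.commute)
    finally show ?thesis .
  qed
  then show thesis using that by blast
qed

subsection \<open>Units of the quotient ring\<close>

text \<open>The class of \<open>Q\<close> inverts that of \<open>P\<close>. Cosets stay hidden:
  later only the congruence of representatives matters.\<close>

lemma poly_quot_unitE:
  assumes "\<phi> dvd P * Q - 1"
  obtains Pbar where "Pbar \<in> Units (poly_quot \<phi>)" and "\<And>R. R \<in> Pbar \<Longrightarrow> \<phi> dvd R - P"
proof -
  let ?R = "ring_of_type_algebra :: complex poly ring"
  let ?I = "PIdl\<^bsub>?R\<^esub> \<phi>"
  interpret R: cring ?R by (rule cring_from_type_algebra)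
  have carrier: "x \<in> carrier ?R" for x by (simp add: ring_of_type_algebra_def)
  interpret ideal ?I ?R by (rule R.cgenideal_ideal[OF carrier])
  have mem: "x \<in> ?I \<longleftrightarrow> \<phi> dvd x" for x
    by (auto simp: cgenideal_def ring_of_type_algebra_def dvd_def mult.commute)
  have add: "x \<oplus>\<^bsub>?R\<^esub> y = x + y" for x y
    by (simp add: ring_of_type_algebra_def)
  have coset: "?I +>\<^bsub>?R\<^esub> x = {y. \<phi> dvd y - x}" for x
  proof -
    have "?I +>\<^bsub>?R\<^esub> x = {h + x |h. \<phi> dvd h}"
      unfolding a_r_coset_def' using mem by (auto simp: add)
    also have "\<dots> = {y. \<phi> dvd y - x}"
      by (auto intro!: exI[of _ "_ - x"])
    finally show ?thesis .
  qed
  have mult: "(?I +>\<^bsub>?R\<^esub> x) \<otimes>\<^bsub>poly_quot \<phi>\<^esub> (?I +>\<^bsub>?R\<^esub> y) = ?I +>\<^bsub>?R\<^esub> (x * y)" for x y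
    using rcoset_mult_add[OF carrier carrier, of x y]
    by (simp add: poly_quot_def FactRing_def) (simp add: ring_of_type_algebra_def)
  have one: "\<one>\<^bsub>poly_quot \<phi>\<^esub> = ?I +>\<^bsub>?R\<^esub> 1"
    by (simp add: poly_quot_def FactRing_def) (simp add: ring_of_type_algebra_def)
  have closed: "?I +>\<^bsub>?R\<^esub> x \<in> carrier (poly_quot \<phi>)" for x
    using carrier by (auto simp: poly_quot_def FactRing_def A_RCOSETS_def')
  \<comment> \<open>The two differences differ by \<open>P * Q - 1\<close>, a multiple of
    \<phi>.\<close>
  have "\<phi> dvd y - P * Q \<longleftrightarrow> \<phi> dvd y - 1" for y
    using dvd_add_left_iff[OF assms, of "y - P * Q"] by simp
  then have "?I +>\<^bsub>?R\<^esub> (P * Q) = ?I +>\<^bsub>?R\<^esub> 1"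
    unfolding coset by simp
  then have "?I +>\<^bsub>?R\<^esub> P \<in> Units (poly_quot \<phi>)"
    unfolding Units_def using closed[of P] closed[of Q] mult[of P Q] mult[of Q P] one
    by (auto simp: mult.commute[of Q P])
  then show thesis by (rule that) (simp add: coset)
qed

subsection \<open>Symmetric factorisations\<close>

text \<open>Dualising a composite reverses it, so symmetry turns the dual of
  \<open>\<theta> \<circ> \<kappa>\<close> into \<open>\<kappa> \<circ> \<theta>\<close>. Both sides
  then equal \<open>\<theta> (\<kappa> (\<theta> \<xi>))\<close>.\<close>

lemma intertwine_of_symmetric:
  fixes \<theta> :: "'v :: complex_vector dual_space \<Rightarrow> 'v"
  assumes fin: "finite_dimensional_vector_space (scaleC :: complex \<Rightarrow> 'v \<Rightarrow> 'v) B"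
    and lin: "clinear \<theta>" "clinear \<kappa>"
    and sym: "dual_map_from_dual \<theta> = \<theta>" "dual_map_to_dual \<kappa> = \<kappa>"
  shows "\<theta> (dual_map (\<theta> \<circ> \<kappa>) \<xi>) = (\<theta> \<circ> \<kappa>) (\<theta> \<xi>)"
proof -
  \<comment> \<open>\<open>inv_into\<close> is a right inverse of \<open>bidual\<close> only on its
    range, which is everything by finite dimension.\<close>
  have "surj (bidual :: 'v \<Rightarrow> _)" using bij_bidual[OF fin] by (rule bij_is_surj)
  then have "bidual (\<theta> \<xi>) = dual_map \<theta> \<xi>" for \<xi>
    by (subst sym(1)[symmetric]) (simp add: dual_map_from_dual_def surj_f_inv_f)
  then have theta: "dual_apply \<eta> (\<theta> \<xi>) = dual_apply \<xi> (\<theta> \<eta>)" for \<eta> \<xi>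
    by (metis dual_apply_bidual dual_apply_dual_map lin(1))
  have kappa: "dual_apply (\<kappa> v) w = dual_apply (\<kappa> w) v" for v w
    by (subst sym(2)[symmetric])
      (simp add: dual_map_to_dual_def dual_apply_dual_map lin dual_apply_bidual)
  have "clinear (\<theta> \<circ> \<kappa>)" using clinear_compose[OF lin] by (simp add: comp_def)
  then have "dual_map (\<theta> \<circ> \<kappa>) \<xi> = \<kappa> (\<theta> \<xi>)"
    using theta kappa
    by (intro dual_apply_inject[THEN iffD1] ext) (simp add: dual_apply_dual_map)
  then show ?thesis by simp
qed

lemma clinear_dual_map: "clinear g \<Longrightarrow> clinear (dual_map g)"
  unfolding clinear_iff[of "dual_map g"]
  by (auto intro!: dual_apply_inject[THEN iffD1] ext
      simp: dual_apply_dual_map plus_dual_space.rep_eq scaleC_dual_space.rep_eq)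

lemma clinear_inv:
  assumes "clinear h" "bij h"
  shows "clinear (inv_into UNIV h)"
  unfolding clinear_iff
  using assms by (auto intro!: inv_f_eq bij_is_inj
      simp: clinear_add clinear_scale bij_is_surj surj_f_inv_f)

text \<open>Elements of \<open>poly_quot \<phi>\<close> are cosets, so the claim covers every
  representative \<open>P\<close>. Bijectivity is asserted so that the total function
  \<open>inv_into\<close> denotes a true inverse.\<close>

theorem proposition1p2:
  fixes f :: "'v :: complex_vector \<Rightarrow> 'v"
    and \<phi> :: "complex poly"
    and r :: nat
    and \<theta>1 \<theta>2 :: "'v dual_space \<Rightarrow> 'v"
    and \<kappa>1 \<kappa>2 :: "'v \<Rightarrow> 'v dual_space"
  assumes "\<exists>B. finite_dimensional_vector_space (scaleC :: complex \<Rightarrow> 'v \<Rightarrow> 'v) B"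
    and "vector_space.dim (scaleC :: complex \<Rightarrow> 'v \<Rightarrow> 'v) UNIV = r"
    and "Polynomial.lead_coeff \<phi> = 1" and "Polynomial.degree \<phi> = r"
    and "f \<in> endos_with_minimal_poly \<phi>"
    and "clinear \<theta>1" and "bij \<theta>1"
    and "clinear \<theta>2" and "bij \<theta>2"
    and "clinear \<kappa>1" and "clinear \<kappa>2"
    and "f = \<theta>1 \<circ> \<kappa>1" and "f = \<theta>2 \<circ> \<kappa>2"
    and "dual_map_from_dual \<theta>1 = \<theta>1" and "dual_map_from_dual \<theta>2 = \<theta>2"
    and "dual_map_to_dual \<kappa>1 = \<kappa>1" and "dual_map_to_dual \<kappa>2 = \<kappa>2"
  shows "\<exists>Pbar \<in> Units (poly_quot \<phi>). \<forall>P \<in> Pbar.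
           \<theta>2 = \<theta>1 \<circ> poly_endo P (dual_map f) \<and>
           bij (poly_endo P (dual_map f)) \<and>
           \<kappa>2 = inv_into UNIV (poly_endo P (dual_map f)) \<circ> \<kappa>1"
proof -
  obtain B where fin: "finite_dimensional_vector_space (scaleC :: complex \<Rightarrow> 'v \<Rightarrow> 'v) B"
    using assms(1) ..
  have lin: "clinear f" and min: "is_minimal_poly \<phi> f"
    using assms(5) by (simp_all add: endos_with_minimal_poly_def)
  have deg: "Polynomial.degree \<phi> = vector_space.dim (scaleC :: complex \<Rightarrow> 'v \<Rightarrow> 'v) UNIV"
    using assms(2,4) by simp
  let ?f' = "dual_map f"
  have lin': "clinear ?f'" by (rule clinear_dual_map[OF lin])
  have t1: "\<theta>1 (?f' \<xi>) = f (\<theta>1 \<xi>)" for \<xi>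
    unfolding \<open>f = \<theta>1 \<circ> \<kappa>1\<close> by (rule intertwine_of_symmetric[OF fin]) fact+
  have t2: "\<theta>2 (?f' \<xi>) = f (\<theta>2 \<xi>)" for \<xi>
    unfolding \<open>f = \<theta>2 \<circ> \<kappa>2\<close> by (rule intertwine_of_symmetric[OF fin]) fact+
  have inv1 [simp]: "inv_into UNIV \<theta>1 (\<theta>1 \<xi>) = \<xi>" "\<theta>1 (inv_into UNIV \<theta>1 v) = v" for \<xi> v
    using \<open>bij \<theta>1\<close> by (simp_all add: bij_is_inj bij_is_surj surj_f_inv_f)
  have inv2 [simp]: "inv_into UNIV \<theta>2 (\<theta>2 \<xi>) = \<xi>" "\<theta>2 (inv_into UNIV \<theta>2 v) = v" for \<xi> v
    using \<open>bij \<theta>2\<close> by (simp_all add: bij_is_inj bij_is_surj surj_f_inv_f)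
  have s1: "inv_into UNIV \<theta>1 (f v) = ?f' (inv_into UNIV \<theta>1 v)"
    and s2: "inv_into UNIV \<theta>2 (f v) = ?f' (inv_into UNIV \<theta>2 v)" for v
    by (metis inv1 t1) (metis inv2 t2)
  obtain P where P: "(\<lambda>v. \<theta>2 (inv_into UNIV \<theta>1 v)) = poly_endo P f"
  proof (rule commuting_is_poly_endo[OF fin lin min deg])
    show "clinear (\<lambda>v. \<theta>2 (inv_into UNIV \<theta>1 v))"
      by (rule clinear_compose[OF \<open>clinear \<theta>2\<close> clinear_inv]) fact+
    show "\<theta>2 (inv_into UNIV \<theta>1 (f v)) = f (\<theta>2 (inv_into UNIV \<theta>1 v))" for v
      by (simp only: s1 t2)
  qed
  obtain Q where Q: "(\<lambda>v. \<theta>1 (inv_into UNIV \<theta>2 v)) = poly_endo Q f"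
  proof (rule commuting_is_poly_endo[OF fin lin min deg])
    show "clinear (\<lambda>v. \<theta>1 (inv_into UNIV \<theta>2 v))"
      by (rule clinear_compose[OF \<open>clinear \<theta>1\<close> clinear_inv]) fact+
    show "\<theta>1 (inv_into UNIV \<theta>2 (f v)) = f (\<theta>1 (inv_into UNIV \<theta>2 v))" for v
      by (simp only: s2 t1)
  qed
  \<comment> \<open>\<open>P(f)\<close> and \<open>Q(f)\<close> are mutually inverse, being
    \<theta>2 after the inverse of \<theta>1 and conversely.\<close>
  have "poly_endo (P * Q - 1) f v = 0" for v
  proof -
    have "poly_endo (P * Q - 1) f v + poly_endo 1 f v = poly_endo (P * Q) f v"
      by (simp only: poly_endo_add[symmetric] diff_add_cancel)
    also have "\<dots> = v"
      by (simp add: poly_endo_mult[OF lin] P[symmetric] Q[symmetric])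
    finally show ?thesis by simp
  qed
  then have "\<phi> dvd P * Q - 1" by (rule minimal_poly_dvd[OF lin min])
  then obtain Pbar where Pbar: "Pbar \<in> Units (poly_quot \<phi>)"
    and dvd: "\<And>R. R \<in> Pbar \<Longrightarrow> \<phi> dvd R - P"
    by (rule poly_quot_unitE) blast
  have "\<theta>2 = \<theta>1 \<circ> poly_endo R ?f' \<and> bij (poly_endo R ?f') \<and>
      \<kappa>2 = inv_into UNIV (poly_endo R ?f') \<circ> \<kappa>1" if "R \<in> Pbar" for R
  proof -
    obtain k where k: "R = P + k * \<phi>"
      using dvd[OF \<open>R \<in> Pbar\<close>] by (metis add.commute diff_add_cancel dvdE mult.commute)
    \<comment> \<open>Representatives differ by a multiple of \<phi>, which vanishes at
      \<open>f\<close>.\<close>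
    have "poly_endo R f v = poly_endo P f v" for v
      using min clinear_zero[OF clinear_poly_endo[OF lin]]
      by (simp add: k poly_endo_add poly_endo_mult[OF lin] is_minimal_poly_def)
    then have eq: "\<theta>1 (poly_endo R ?f' \<xi>) = \<theta>2 \<xi>" for \<xi>
      by (simp add: poly_endo_intertwine[OF lin' lin \<open>clinear \<theta>1\<close> t1] P[symmetric])
    then have R: "poly_endo R ?f' = (\<lambda>\<xi>. inv_into UNIV \<theta>1 (\<theta>2 \<xi>))"
      by (metis inv1(1))
    have bij: "bij (poly_endo R ?f')"
      unfolding R by (rule bijI') (metis inv1 inv2)+
    have "inv_into UNIV (poly_endo R ?f') = (\<lambda>\<xi>. inv_into UNIV \<theta>2 (\<theta>1 \<xi>))"
      by (rule inv_equality) (simp_all add: R)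
    \<comment> \<open>Apply the inverse of \<theta>2 to
      \<open>\<theta>1 (\<kappa>1 v) = \<theta>2 (\<kappa>2 v)\<close>.\<close>
    moreover have "\<kappa>2 v = inv_into UNIV \<theta>2 (\<theta>1 (\<kappa>1 v))" for v
      by (metis assms(12,13) comp_apply inv2(1))
    ultimately show ?thesis using eq bij by (auto simp: fun_eq_iff)
  qed
  then show ?thesis using Pbar by blast
qed

end
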